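(* The following graphs are single approval interval graphs: (1) the complete graphs $K_n$ for every positive integer $n$; (2) the cycles $C_n$ for every $n\ge3$; (3) the wheels $W_n$ for every $n\ge 3$; (4) all (finite) trees; (5) all complete $k$-partite graphs.
   Context: All graphs are finite and simple. The wheel $W_n$ is the graph on $n+1$ vertices obtained from the cycle $C_n$ by adding one vertex adjacent to all cycle vertices. An approval interval is a triple $I(a)=(a_l,a_a,a_r)$ of reals with $a_l<a_a<a_r$: the closed interval $[a_l,a_r]$ with approval mark $a_a$. A single approval interval representation of a graph $G$ assigns to each vertex $a$ an approval interval $I(a)$ such that distinct vertices $a,b$ are adjacent if and only if $[a_l,a_r]$ and $[b_l,b_r]$ intersect and their intersection contains exactly one of the two approval marks $a_a,b_a$. A graph is a single approval interval graph if it has such a representation. *)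

theory Defs
  imports "Graph_Theory.Graph_Theory" "HOL-Library.Disjoint_Sets"
begin

text \<open>
  Finite simple graphs are the symmetric digraphs of the locale \<open>graph\<close>: finite, loop-free,
  without parallel arcs, and with every edge present as a pair of opposite arcs. The named families
  are predicates on graphs, i.e. they describe all isomorphic copies, in the same style as the
  library's \<open>complete_digraph\<close>.
\<close>

definition cycle_graph :: "nat \<Rightarrow> ('a,'b) pre_digraph \<Rightarrow> bool" where
  "cycle_graph n G \<longleftrightarrow> graph G \<and> (\<exists>f. bij_betw f {..<n} (verts G) \<and>
     arcs_ends G = (\<Union>i<n. {(f i, f (Suc i mod n)), (f (Suc i mod n), f i)}))"

definition wheel_graph :: "nat \<Rightarrow> ('a,'b) pre_digraph \<Rightarrow> bool" where
  "wheel_graph n G \<longleftrightarrow> graph G \<and> (\<exists>c\<in>verts G.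
     cycle_graph n (G \<restriction> (verts G - {c})) \<and> (\<forall>v\<in>verts G - {c}. c \<rightarrow>\<^bsub>G\<^esub> v))"

text \<open>
  The library's \<open>tree\<close> is not the right notion here: in a symmetric digraph every edge, traversed
  back and forth, is a \<open>cycle\<close> of length 2. Such degenerate cycles are excluded below; in a loop-free
  graph without parallel arcs, the cycles of length at least 3 are the cycles of the undirected
  graph. \<open>Digraph_Component.connected\<close> requires at least one vertex.
\<close>

definition undirected_tree :: "('a,'b) pre_digraph \<Rightarrow> bool" where
  "undirected_tree G \<longleftrightarrow> graph G \<and> Digraph_Component.connected G \<and>
     \<not> (\<exists>p. pre_digraph.cycle G p \<and> 3 \<le> length p)"

text \<open>The \<open>k\<close> parts are nonempty, as required by \<open>partition_on\<close>.\<close>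

definition complete_multipartite_graph :: "nat \<Rightarrow> ('a,'b) pre_digraph \<Rightarrow> bool" where
  "complete_multipartite_graph k G \<longleftrightarrow> graph G \<and> (\<exists>P. partition_on (verts G) P \<and> card P = k \<and>
     arcs_ends G = {(u,v). \<exists>A\<in>P. \<exists>B\<in>P. A \<noteq> B \<and> u \<in> A \<and> v \<in> B})"

record approval_triple =
  ai_left :: real
  ai_mark :: real
  ai_right :: real

definition approval_interval :: "approval_triple \<Rightarrow> bool" where
  "approval_interval J \<longleftrightarrow> ai_left J < ai_mark J \<and> ai_mark J < ai_right J"

definition ai_set :: "approval_triple \<Rightarrow> real set" where
  "ai_set J = {ai_left J..ai_right J}"

text \<open>
  The two marks are counted as marks of two different vertices, so coinciding marks in the
  intersection count as two.
\<close>

definition single_approval :: "approval_triple \<Rightarrow> approval_triple \<Rightarrow> bool" where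
  "single_approval J K \<longleftrightarrow> ai_set J \<inter> ai_set K \<noteq> {} \<and>
     (ai_mark J \<in> ai_set J \<inter> ai_set K) \<noteq> (ai_mark K \<in> ai_set J \<inter> ai_set K)"

definition single_approval_interval_representation ::
    "('a,'b) pre_digraph \<Rightarrow> ('a \<Rightarrow> approval_triple) \<Rightarrow> bool" where
  "single_approval_interval_representation G I \<longleftrightarrow>
     (\<forall>a\<in>verts G. approval_interval (I a)) \<and>
     (\<forall>a\<in>verts G. \<forall>b\<in>verts G. a \<noteq> b \<longrightarrow> (a \<rightarrow>\<^bsub>G\<^esub> b \<longleftrightarrow> single_approval (I a) (I b)))"

definition single_approval_interval_graph :: "('a,'b) pre_digraph \<Rightarrow> bool" where
  "single_approval_interval_graph G \<longleftrightarrow>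
     graph G \<and> (\<exists>I. single_approval_interval_representation G I)"

end

theory Submission
  imports Defs
begin

text \<open>
  Every mark lies in its own interval, so two vertices are adjacent iff exactly one of them contains
  the mark of the other.

  Complete multipartite graphs: the vertices of the \<open>i\<close>-th part get mark \<open>i\<close> and an interval reaching
  only to the right, past all marks.

  Cycles: with marks \<open>0, \<dots>, n - 1\<close>, let every interval contain the preceding mark and the next two.
  Neighbours contain each other, so only marks at distance 2 are adjacent, which gives the two
  paths of even and odd positions. Withdrawing the left ends of the intervals at \<open>1\<close> and \<open>n - 1\<close>
  joins these paths at both ends. Wheels: a vertex whose interval contains everything
  and whose mark lies to the right of all other intervals is adjacent to all other vertices.

  Trees: label the root by \<open>1\<close> and the children of a vertex \<open>k\<close> by distinct numbers between \<open>N * k\<close>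
  and \<open>N * k + N - 1\<close>, so that the parent of \<open>k\<close> is \<open>k div N\<close>. The interval of \<open>k\<close> begins
  just after its parent and ends just after its last possible child. For \<open>k < l\<close>, the interval of
  \<open>k\<close> contains \<open>l\<close> iff \<open>l div N \<le> k\<close>, and that of \<open>l\<close> contains \<open>k\<close> iff \<open>l div N < k\<close>.
\<close>

section \<open>Adjacency read off from the marks\<close>

text \<open>Each mark lies in its own interval, so a mark contained in the other interval is a
  common point; non-emptiness of the intersection is then automatic.\<close>

lemma single_approval_iff:
  assumes "approval_interval J" "approval_interval K"
  shows "single_approval J K \<longleftrightarrow> (ai_mark J \<in> ai_set K) \<noteq> (ai_mark K \<in> ai_set J)"
proof -
  have "ai_mark J \<in> ai_set J" "ai_mark K \<in> ai_set K"
    using assms by (auto simp: approval_interval_def ai_set_def)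
  then show ?thesis
    unfolding single_approval_def by blast
qed

lemma single_approval_interval_graphI:
  assumes "graph G"
    and "\<And>a. a \<in> verts G \<Longrightarrow> approval_interval (I a)"
    and "\<And>a b. a \<in> verts G \<Longrightarrow> b \<in> verts G \<Longrightarrow> a \<noteq> b \<Longrightarrow>
      a \<rightarrow>\<^bsub>G\<^esub> b \<longleftrightarrow> (ai_mark (I a) \<in> ai_set (I b)) \<noteq> (ai_mark (I b) \<in> ai_set (I a))"
  shows "single_approval_interval_graph G"
  unfolding single_approval_interval_graph_def single_approval_interval_representation_def
  using assms by (auto intro!: exI[of _ I] simp: single_approval_iff)

subsection \<open>Complete multipartite graphs\<close>

text \<open>Of two different colours, only the interval of the smaller one contains the other mark;
  equal colours give equal intervals, each containing both marks. This serves multipartite graphs,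
  with numbered parts as colours, and complete graphs, with an injective colouring.\<close>

lemma single_approval_interval_graph_if_colouring:
  fixes h :: "'a \<Rightarrow> nat"
  assumes G: "graph G"
    and adj: "\<And>a b. a \<in> verts G \<Longrightarrow> b \<in> verts G \<Longrightarrow> a \<noteq> b \<Longrightarrow> a \<rightarrow>\<^bsub>G\<^esub> b \<longleftrightarrow> h a \<noteq> h b"
  shows "single_approval_interval_graph G"
proof -
  interpret graph G by fact
  define K where "K = Max (h ` verts G)"
  have K: "h a \<le> K" if "a \<in> verts G" for a
    using that by (simp add: K_def)
  \<comment> \<open>Half a unit to the left of its mark, the interval misses every smaller
    colour.\<close>
  define I where "I a = \<lparr>ai_left = real (h a) - 1/2, ai_mark = real (h a), ai_right = real K + 1\<rparr>" for a
  have mem: "ai_mark (I a) \<in> ai_set (I b) \<longleftrightarrow> h b \<le> h a" if "a \<in> verts G" for a b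
    using K[OF that] by (auto simp: I_def ai_set_def)
  show ?thesis
  proof (rule single_approval_interval_graphI[OF G, of I])
    fix a assume "a \<in> verts G"
    then show "approval_interval (I a)"
      using K[of a] by (simp add: I_def approval_interval_def)
  next
    fix a b assume "a \<in> verts G" "b \<in> verts G" "a \<noteq> b"
    then show "a \<rightarrow>\<^bsub>G\<^esub> b \<longleftrightarrow> (ai_mark (I a) \<in> ai_set (I b)) \<noteq> (ai_mark (I b) \<in> ai_set (I a))"
      by (auto simp: adj mem)
  qed
qed

lemma complete_digraph_single_approval:
  assumes "complete_digraph n G"
  shows "single_approval_interval_graph G"
proof -
  have G: "graph G" and ends: "arcs_ends G = {(u,v). (u,v) \<in> verts G \<times> verts G \<and> u \<noteq> v}"
    using assms by (auto simp: complete_digraph_def)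
  interpret graph G by fact
  obtain h :: "_ \<Rightarrow> nat" where "inj_on h (verts G)"
    using finite_imp_inj_to_nat_seg[OF finite_verts] by blast
  then show ?thesis
    by (intro single_approval_interval_graph_if_colouring[OF G, of h]) (auto simp: ends inj_on_eq_iff)
qed

lemma complete_multipartite_single_approval:
  assumes "complete_multipartite_graph k G"
  shows "single_approval_interval_graph G"
proof -
  obtain P where G: "graph G" and P: "partition_on (verts G) P"
    and ends: "arcs_ends G = {(u,v). \<exists>A\<in>P. \<exists>B\<in>P. A \<noteq> B \<and> u \<in> A \<and> v \<in> B}"
    using assms by (auto simp: complete_multipartite_graph_def)
  interpret graph G by fact
  have "finite P"
    using P finite_verts by (rule finite_elements[rotated])
  then obtain g :: "_ \<Rightarrow> nat" where g: "inj_on g P"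
    using finite_imp_inj_to_nat_seg by blast
  define part where "part v = (THE A. A \<in> P \<and> v \<in> A)" for v
  have part_eq: "part v = A" if "A \<in> P" "v \<in> A" for v A
    unfolding part_def
    by (rule the_equality) (use that partition_onD2[OF P] in \<open>auto simp: disjoint_def\<close>)
  have part: "part v \<in> P" "v \<in> part v" if "v \<in> verts G" for v
    using partition_onD1[OF P] that part_eq by auto
  show ?thesis
  proof (rule single_approval_interval_graph_if_colouring[OF G, of "\<lambda>v. g (part v)"])
    fix a b assume ab: "a \<in> verts G" "b \<in> verts G"
    have "a \<rightarrow>\<^bsub>G\<^esub> b \<longleftrightarrow> part a \<noteq> part b"
      using part[OF ab(1)] part[OF ab(2)] part_eq unfolding ends by blast
    then show "a \<rightarrow>\<^bsub>G\<^esub> b \<longleftrightarrow> g (part a) \<noteq> g (part b)"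
      using part ab g by (simp add: inj_on_eq_iff)
  qed
qed

subsection \<open>Cycles and wheels\<close>

text \<open>Position on the real line of the \<open>i\<close>-th vertex of the cycle: the tour
  starts at 0, climbs through the odd positions and returns through the even ones down to 2.\<close>

definition zigzag :: "nat \<Rightarrow> nat \<Rightarrow> nat" where
  "zigzag n i = (if i = 0 then 0 else if 2 * i \<le> n then 2 * i - 1 else 2 * (n - i))"

text \<open>The two paths of odd and even positions, joined at the bottom by \<open>{0, 1}\<close>
  and at the top by \<open>{n - 2, n - 1}\<close>.\<close>

definition zigzag_adjacent :: "nat \<Rightarrow> nat \<Rightarrow> nat \<Rightarrow> bool" where
  "zigzag_adjacent n k l \<longleftrightarrow> l = k + 2 \<or> k = l + 2 \<or> {k, l} = {0, 1} \<or> {k, l} = {n - 2, n - 1}"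

text \<open>The cases follow the tour: \<open>i\<close> at the start, both vertices on the odd arm,
  one on each arm, or both on the even arm.\<close>

lemma zigzag_less:
  assumes n: "3 \<le> n" and ij: "i < j" "j < n"
  shows zigzag_neq: "zigzag n i \<noteq> zigzag n j"
    and zigzag_adjacent_iff_less:
      "zigzag_adjacent n (zigzag n i) (zigzag n j) \<longleftrightarrow> j = Suc i \<or> i = 0 \<and> Suc j = n"
proof -
  consider "i = 0" "2 * j \<le> n" | "i = 0" "n < 2 * j" | "0 < i" "2 * j \<le> n"
    | "0 < i" "2 * i \<le> n" "n < 2 * j" | "n < 2 * i"
    using ij by linarith
  then have "zigzag n i \<noteq> zigzag n j \<and> (zigzag_adjacent n (zigzag n i) (zigzag n j) \<longleftrightarrow>
    j = Suc i \<or> i = 0 \<and> Suc j = n)"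
  proof cases
    case 4
    \<comment> \<open>This substitution removes the truncated subtractions from both
      positions.\<close>
    obtain i' d where i': "i = Suc i'" and d: "n = j + d"
      using \<open>0 < i\<close> \<open>j < n\<close> by (metis gr0_implies_Suc less_imp_add_positive)
    have *: "zigzag n i = 2 * i' + 1" "zigzag n j = 2 * d"
      using 4 ij by (auto simp: zigzag_def i' d)
    \<comment> \<open>By parity, positions on different arms neither coincide nor differ by 2. As
      \<open>0 < d\<close>, only the joining edge at the top remains.\<close>
    have "2 * i' + 1 \<noteq> 2 * d" "2 * d \<noteq> 2 * i' + 3" "2 * i' + 1 \<noteq> 2 * d + 2"
      by presburger+
    then show ?thesis
      using n ij 4 unfolding * zigzag_adjacent_def doubleton_eq_iff
      unfolding i' d by auto
  qed (use n ij in \<open>auto simp: zigzag_def zigzag_adjacent_def doubleton_eq_iff\<close>)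
  then show "zigzag n i \<noteq> zigzag n j"
    and "zigzag_adjacent n (zigzag n i) (zigzag n j) \<longleftrightarrow> j = Suc i \<or> i = 0 \<and> Suc j = n"
    by auto
qed

lemma inj_on_zigzag: "3 \<le> n \<Longrightarrow> inj_on (zigzag n) {..<n}"
  by (rule linorder_inj_onI) (auto simp: zigzag_neq)

lemma zigzag_adjacent_iff:
  assumes "3 \<le> n" "i < n" "j < n"
  shows "zigzag_adjacent n (zigzag n i) (zigzag n j) \<longleftrightarrow> j = Suc i mod n \<or> i = Suc j mod n"
proof -
  have *: "Suc m mod n = (if Suc m = n then 0 else Suc m)" if "m < n" for m
    using that by auto
  have sym: "zigzag_adjacent n k l \<longleftrightarrow> zigzag_adjacent n l k" for k l
    unfolding zigzag_adjacent_def doubleton_eq_iff by blast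
  consider "i < j" | "j < i" | "i = j"
    by linarith
  then show ?thesis
  proof cases
    case 1
    show ?thesis
      unfolding zigzag_adjacent_iff_less[OF assms(1) 1 assms(3)] using assms 1 by (auto simp: *)
  next
    case 2
    show ?thesis
      unfolding sym[of "zigzag n i"] zigzag_adjacent_iff_less[OF assms(1) 2 assms(2)]
      using assms 2 by (auto simp: *)
  next
    case 3
    then show ?thesis
      using assms by (auto simp: * zigzag_adjacent_def doubleton_eq_iff)
  qed
qed

lemma cycle_graph_single_approval:
  assumes n: "3 \<le> n" and "cycle_graph n G"
  shows "single_approval_interval_graph G"
proof -
  obtain f where G: "graph G" and f: "bij_betw f {..<n} (verts G)"
    and ends: "arcs_ends G = (\<Union>i<n. {(f i, f (Suc i mod n)), (f (Suc i mod n), f i)})"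
    using assms by (auto simp: cycle_graph_def)
  define ix where "ix = the_inv_into {..<n} f"
  define p where "p a = zigzag n (ix a)" for a
  \<comment> \<open>The closed end at distance 1 just reaches the preceding mark, the one at
    distance 1/2 misses it. The latter makes containment one-sided between 0 and 1 and between
    \<open>n - 2\<close> and \<open>n - 1\<close>.\<close>
  define l :: "nat \<Rightarrow> real" where "l k = k - (if k = 1 \<or> k = n - 1 then 1/2 else 1)" for k
  define I where "I a = \<lparr>ai_left = l (p a), ai_mark = p a, ai_right = real (p a) + 2\<rparr>" for a
  have ix: "ix a < n" "f (ix a) = a" if "a \<in> verts G" for a
    using the_inv_into_into[of f "{..<n}" a "{..<n}"] f_the_inv_into_f_bij_betw[OF f, of a] f that
    by (auto simp: ix_def bij_betw_def)
  have ix_f: "ix (f i) = i" if "i < n" for i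
    using f that by (auto simp: ix_def bij_betw_def the_inv_into_f_f)
  have adj: "a \<rightarrow>\<^bsub>G\<^esub> b \<longleftrightarrow> ix b = Suc (ix a) mod n \<or> ix a = Suc (ix b) mod n"
    if a: "a \<in> verts G" and b: "b \<in> verts G" for a b
  proof
    assume "a \<rightarrow>\<^bsub>G\<^esub> b"
    then show "ix b = Suc (ix a) mod n \<or> ix a = Suc (ix b) mod n"
      using n by (auto simp: ends ix_f)
  next
    assume "ix b = Suc (ix a) mod n \<or> ix a = Suc (ix b) mod n"
    then show "a \<rightarrow>\<^bsub>G\<^esub> b"
      unfolding ends using ix[OF a] ix[OF b] by (metis (no_types, lifting) UN_I insertCI lessThan_iff)
  qed
  have mem: "ai_mark (I a) \<in> ai_set (I b) \<longleftrightarrow>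
      (if p b = 1 \<or> p b = n - 1 then p b \<le> p a else p b \<le> p a + 1) \<and> p a \<le> p b + 2" for a b
    by (auto simp: I_def ai_set_def l_def)
  show ?thesis
  proof (rule single_approval_interval_graphI[OF G, of I])
    fix a show "approval_interval (I a)"
      by (simp add: I_def approval_interval_def l_def)
  next
    fix a b assume ab: "a \<in> verts G" "b \<in> verts G" "a \<noteq> b"
    have "ix a \<noteq> ix b"
      using ix ab by metis
    then have ne: "p a \<noteq> p b"
      unfolding p_def using inj_on_eq_iff[OF inj_on_zigzag[OF n]] ix ab by auto
    have "p a < n" "p b < n"
      using ix[OF ab(1)] ix[OF ab(2)] by (auto simp: p_def zigzag_def)
    then have "zigzag_adjacent n (p a) (p b) \<longleftrightarrow>
        (ai_mark (I a) \<in> ai_set (I b)) \<noteq> (ai_mark (I b) \<in> ai_set (I a))"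
      unfolding mem zigzag_adjacent_def doubleton_eq_iff
      using ne n by (cases "p a" "p b" rule: linorder_cases) auto
    then show "a \<rightarrow>\<^bsub>G\<^esub> b \<longleftrightarrow> (ai_mark (I a) \<in> ai_set (I b)) \<noteq> (ai_mark (I b) \<in> ai_set (I a))"
      using adj[OF ab(1,2)] zigzag_adjacent_iff[OF n ix(1)[OF ab(1)] ix(1)[OF ab(2)]]
      by (simp add: p_def)
  qed
qed

text \<open>The old intervals are kept, so adjacency among the old vertices is untouched. For
  wheels, \<open>c\<close> is the hub.\<close>

lemma single_approval_interval_graph_dominating_vertex:
  assumes G: "graph G" and c: "\<And>v. v \<in> verts G - {c} \<Longrightarrow> c \<rightarrow>\<^bsub>G\<^esub> v"
    and H: "single_approval_interval_graph (G \<restriction> (verts G - {c}))"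
  shows "single_approval_interval_graph G"
proof -
  interpret graph G by fact
  let ?V = "verts G - {c}"
  obtain I where I: "\<And>a. a \<in> ?V \<Longrightarrow> approval_interval (I a)"
    and adj: "\<And>a b. a \<in> ?V \<Longrightarrow> b \<in> ?V \<Longrightarrow> a \<noteq> b \<Longrightarrow>
      a \<rightarrow>\<^bsub>G \<restriction> ?V\<^esub> b \<longleftrightarrow> single_approval (I a) (I b)"
    using H by (auto simp: single_approval_interval_graph_def
        single_approval_interval_representation_def)
  \<comment> \<open>A sum of absolute values bounds all endpoints and is 0, rather than unspecified
    like \<open>Max\<close>, if \<open>c\<close> is the only vertex.\<close>
  define M where "M = (\<Sum>a\<in>?V. \<bar>ai_left (I a)\<bar> + \<bar>ai_right (I a)\<bar>)"
  have M: "\<bar>ai_left (I a)\<bar> + \<bar>ai_right (I a)\<bar> \<le> M" if "a \<in> ?V" for a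
    unfolding M_def by (rule member_le_sum) (use that in auto)
  have "0 \<le> M"
    unfolding M_def by (intro sum_nonneg) auto
  define J where "J = I(c := \<lparr>ai_left = - M - 1, ai_mark = M + 1, ai_right = M + 2\<rparr>)"
  have J: "approval_interval (J a)" if "a \<in> verts G" for a
    using I[of a] that \<open>0 \<le> M\<close> by (auto simp: J_def approval_interval_def)
  have in_c: "ai_mark (J a) \<in> ai_set (J c)" and not_in: "ai_mark (J c) \<notin> ai_set (J a)"
    if "a \<in> ?V" for a
    using M[OF that] I[OF that] that by (auto simp: J_def ai_set_def approval_interval_def)
  have c': "v \<rightarrow>\<^bsub>G\<^esub> c" if "v \<in> ?V" for v
    using arcs_ends_symmetric[OF sym_arcs c[OF that]] .
  show ?thesis
  proof (rule single_approval_interval_graphI[OF G, of J])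
    fix a b assume ab: "a \<in> verts G" "b \<in> verts G" "a \<noteq> b"
    consider "a = c" "b \<in> ?V" | "b = c" "a \<in> ?V" | "a \<in> ?V" "b \<in> ?V"
      using ab by auto
    then show "a \<rightarrow>\<^bsub>G\<^esub> b \<longleftrightarrow> (ai_mark (J a) \<in> ai_set (J b)) \<noteq> (ai_mark (J b) \<in> ai_set (J a))"
    proof cases
      case 3
      then have "a \<rightarrow>\<^bsub>G\<^esub> b \<longleftrightarrow> a \<rightarrow>\<^bsub>G \<restriction> ?V\<^esub> b"
        by (auto simp: arcs_ends_conv)
      then show ?thesis
        using 3 adj[OF 3 ab(3)] single_approval_iff[OF I I, OF 3] by (simp add: J_def)
    qed (use in_c not_in c c' in auto)
  qed (rule J)
qed

subsection \<open>Trees\<close>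

lemma single_approval_interval_graph_if_parent_labelling:
  fixes x :: "'a \<Rightarrow> nat"
  assumes G: "graph G" and N: "2 \<le> N" and inj: "inj_on x (verts G)"
    and pos: "\<And>a. a \<in> verts G \<Longrightarrow> 0 < x a"
    and adj: "\<And>a b. a \<in> verts G \<Longrightarrow> b \<in> verts G \<Longrightarrow> a \<noteq> b \<Longrightarrow>
      a \<rightarrow>\<^bsub>G\<^esub> b \<longleftrightarrow> x a = x b div N \<or> x b = x a div N"
  shows "single_approval_interval_graph G"
proof -
  \<comment> \<open>The half-integer ends turn membership of a label \<open>m\<close> into the
    strict bounds \<open>x a div N < m\<close> and \<open>m < N * x a + N\<close>.\<close>
  define I where "I a = \<lparr>ai_left = real (x a div N) + 1/2, ai_mark = real (x a),
    ai_right = real (N * x a + N) - 1/2\<rparr>" for a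
  have parent: "x a div N < x a" if "a \<in> verts G" for a
    using pos[OF that] N by simp
  have mem: "ai_mark (I a) \<in> ai_set (I b) \<longleftrightarrow> x b div N < x a \<and> x a div N \<le> x b" for a b
  proof -
    have "x a < N * x b + N \<longleftrightarrow> x a div N \<le> x b"
      using div_less_iff_less_mult[of N "x a" "Suc (x b)"] N by (auto simp: algebra_simps)
    moreover have "real (x b div N) + 1/2 \<le> real (x a) \<longleftrightarrow> x b div N < x a"
      by linarith
    moreover have "real (x a) \<le> real (N * x b + N) - 1/2 \<longleftrightarrow> x a < N * x b + N"
      by linarith
    ultimately show ?thesis
      by (simp add: I_def ai_set_def)
  qed
  show ?thesis
  proof (rule single_approval_interval_graphI[OF G, of I])
    fix a assume a: "a \<in> verts G"
    have "x a < N * x a + N"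
      using N by (cases N) auto
    then have "real (x a) < real (N * x a + N) - 1/2"
      by linarith
    moreover have "real (x a div N) + 1/2 < real (x a)"
      using parent[OF a] by linarith
    ultimately show "approval_interval (I a)"
      by (simp add: I_def approval_interval_def)
  next
    fix a b assume ab: "a \<in> verts G" "b \<in> verts G" "a \<noteq> b"
    have "x a \<noteq> x b"
      using inj ab by (auto simp: inj_on_eq_iff)
    \<comment> \<open>If \<open>x a < x b\<close>, the two memberships reduce to
      \<open>x b div N \<le> x a\<close> and \<open>x b div N < x a\<close>; they disagree exactly
      when \<open>x a\<close> is the parent label of \<open>x b\<close>.\<close>
    then show "a \<rightarrow>\<^bsub>G\<^esub> b \<longleftrightarrow> (ai_mark (I a) \<in> ai_set (I b)) \<noteq> (ai_mark (I b) \<in> ai_set (I a))"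
      using parent[OF ab(1)] parent[OF ab(2)] unfolding adj[OF ab] mem by linarith
  qed
qed

section \<open>Growing a tree leaf by leaf\<close>

text \<open>Connectedness inside \<open>S\<close>, phrased with simple paths of the whole graph so
  that they can be closed directly to a \<open>cycle\<close>.\<close>

definition (in pre_digraph) apath_connected :: "'a set \<Rightarrow> bool" where
  "apath_connected S \<longleftrightarrow> (\<forall>u\<in>S. \<forall>v\<in>S. \<exists>p. apath u p v \<and> set (awalk_verts u p) \<subseteq> S)"

lemma (in wf_digraph) obtain_arc_leaving:
  assumes "u \<rightarrow>\<^sup>*\<^bsub>G\<^esub> v" "u \<in> S" "v \<notin> S"
  obtains a b where "a \<in> S" "b \<notin> S" "a \<rightarrow>\<^bsub>G\<^esub> b"
proof -
  have "\<exists>a b. a \<in> S \<and> b \<notin> S \<and> a \<rightarrow>\<^bsub>G\<^esub> b"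
    using assms by (induction rule: reachable_induct) blast+
  then show ?thesis
    using that by blast
qed

text \<open>Prolonging a path in \<open>S\<close> by an arc from or to \<open>w\<close> keeps it
  simple, since \<open>w\<close> lies outside \<open>S\<close>.\<close>

lemma (in sym_digraph) apath_connected_insert:
  assumes S: "apath_connected S" and "v \<in> S" "w \<notin> S" "v \<rightarrow>\<^bsub>G\<^esub> w"
  shows "apath_connected (insert w S)"
proof -
  have "w \<rightarrow>\<^bsub>G\<^esub> v"
    using arcs_ends_symmetric[OF sym_arcs \<open>v \<rightarrow>\<^bsub>G\<^esub> w\<close>] .
  then obtain e' where e': "e' \<in> arcs G" "tail G e' = w" "head G e' = v"
    by (auto simp: arcs_ends_conv)
  obtain e where e: "e \<in> arcs G" "tail G e = v" "head G e = w"
    using \<open>v \<rightarrow>\<^bsub>G\<^esub> w\<close> by (auto simp: arcs_ends_conv)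
  show ?thesis
    unfolding apath_connected_def
  proof (intro ballI)
    fix a b assume ab: "a \<in> insert w S" "b \<in> insert w S"
    consider "a = w" "b = w" | "a \<in> S" "b \<in> S" | "a = w" "b \<in> S" | "a \<in> S" "b = w"
      using ab by auto
    then show "\<exists>p. apath a p b \<and> set (awalk_verts a p) \<subseteq> insert w S"
    proof cases
      case 1
      then show ?thesis
        using e by (auto intro!: exI[of _ "[]"] simp: apath_Nil_iff)
    next
      case 2
      then show ?thesis
        using S unfolding apath_connected_def by blast
    next
      case 3
      obtain p where "apath v p b" "set (awalk_verts v p) \<subseteq> S"
        using S 3 \<open>v \<in> S\<close> unfolding apath_connected_def by blast
      then have "apath w (e' # p) b \<and> set (awalk_verts w (e' # p)) \<subseteq> insert w S"
        using e' \<open>w \<notin> S\<close> by (auto simp: apath_Cons_iff)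
      then show ?thesis
        using 3 by blast
    next
      case 4
      obtain p where p: "apath a p v" "set (awalk_verts a p) \<subseteq> S"
        using S 4 \<open>v \<in> S\<close> unfolding apath_connected_def by blast
      have "awalk v [e] w"
        using e arc_implies_awalk by auto
      then have walk: "awalk a (p @ [e]) w"
        using p(1) awalk_appendI by (auto simp: apath_def)
      have "awalk_verts a (p @ [e]) = awalk_verts a p @ [w]"
        using p(1) e awalk_verts_append[OF walk] by (simp add: apath_def)
      with walk have "apath a (p @ [e]) w \<and> set (awalk_verts a (p @ [e])) \<subseteq> insert w S"
        using p \<open>w \<notin> S\<close> by (auto simp: apath_def)
      then show ?thesis
        using 4 by blast
    qed
  qed
qed

text \<open>Otherwise a path in \<open>S\<close> from \<open>u\<close> to \<open>v\<close> closes
  through \<open>w\<close> to a cycle.\<close>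

lemma (in sym_digraph) unique_neighbour_if_acyclic:
  assumes acyclic: "\<not> (\<exists>p. cycle p \<and> 3 \<le> length p)"
    and S: "apath_connected S" and "u \<in> S" "v \<in> S" "w \<notin> S" "u \<rightarrow>\<^bsub>G\<^esub> w" "v \<rightarrow>\<^bsub>G\<^esub> w"
  shows "u = v"
proof (rule ccontr)
  assume "u \<noteq> v"
  obtain p where p: "apath u p v" "set (awalk_verts u p) \<subseteq> S"
    using S \<open>u \<in> S\<close> \<open>v \<in> S\<close> unfolding apath_connected_def by blast
  have "w \<rightarrow>\<^bsub>G\<^esub> u"
    using arcs_ends_symmetric[OF sym_arcs \<open>u \<rightarrow>\<^bsub>G\<^esub> w\<close>] .
  then obtain e' where e': "e' \<in> arcs G" "tail G e' = w" "head G e' = u"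
    by (auto simp: arcs_ends_conv)
  obtain e where e: "e \<in> arcs G" "tail G e = v" "head G e = w"
    using \<open>v \<rightarrow>\<^bsub>G\<^esub> w\<close> by (auto simp: arcs_ends_conv)
  \<comment> \<open>A nonempty \<open>p\<close> makes the closed walk have at least 3 arcs, which
    rules out a degenerate cycle of length 2.\<close>
  have "p \<noteq> []"
    using p(1) \<open>u \<noteq> v\<close> by (auto simp: apath_Nil_iff)
  have "awalk v [e] w"
    using e arc_implies_awalk by auto
  then have walk: "awalk u (p @ [e]) w"
    using p(1) awalk_appendI by (auto simp: apath_def)
  have "awalk_verts u (p @ [e]) = awalk_verts u p @ [w]"
    using p(1) e awalk_verts_append[OF walk] by (simp add: apath_def)
  moreover have "awalk w (e' # p @ [e]) w"
    using walk e' by (auto simp: awalk_Cons_iff)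
  ultimately have "cycle (e' # p @ [e])"
    unfolding cycle_def using e' p \<open>w \<notin> S\<close> by (intro exI[of _ w]) (auto simp: apath_def)
  moreover have "3 \<le> length (e' # p @ [e])"
    using \<open>p \<noteq> []\<close> by (cases p) auto
  ultimately show False
    using acyclic by blast
qed

text \<open>Parent labels must already be in use, or be 0, which labels no vertex. Hence a fresh
  positive label is never the parent of an old vertex.\<close>

definition (in pre_digraph) parent_labelling :: "nat \<Rightarrow> 'a set \<Rightarrow> ('a \<Rightarrow> nat) \<Rightarrow> bool" where
  "parent_labelling N S x \<longleftrightarrow> inj_on x S \<and>
     (\<forall>a\<in>S. 0 < x a \<and> x a div N \<in> insert 0 (x ` S)) \<and>
     (\<forall>a\<in>S. \<forall>b\<in>S. a \<rightarrow>\<^bsub>G\<^esub> b \<longleftrightarrow> x a = x b div N \<or> x b = x a div N)"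

text \<open>By pigeonhole, one of the \<open>N\<close> child labels of \<open>v\<close> is free, as
  \<open>S\<close> has fewer than \<open>N\<close> elements; \<open>w\<close> receives it.\<close>

lemma (in graph) parent_labelling_insert:
  assumes x: "parent_labelling N S x" and "finite S" "card S < N" "2 \<le> N"
    and "v \<in> S" "w \<notin> S" and nb: "\<And>u. u \<in> S \<Longrightarrow> u \<rightarrow>\<^bsub>G\<^esub> w \<longleftrightarrow> u = v"
  obtains y where "parent_labelling N (insert w S) y"
proof -
  have inj: "inj_on x S" and pos: "\<And>a. a \<in> S \<Longrightarrow> 0 < x a"
    and closed: "\<And>a. a \<in> S \<Longrightarrow> x a div N \<in> insert 0 (x ` S)"
    and adj: "\<And>a b. a \<in> S \<Longrightarrow> b \<in> S \<Longrightarrow> a \<rightarrow>\<^bsub>G\<^esub> b \<longleftrightarrow> x a = x b div N \<or> x b = x a div N"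
    using x unfolding parent_labelling_def by auto
  have "\<not> (\<lambda>j. N * x v + j) ` {..<N} \<subseteq> x ` S"
  proof
    assume "(\<lambda>j. N * x v + j) ` {..<N} \<subseteq> x ` S"
    then have "card ((\<lambda>j. N * x v + j) ` {..<N}) \<le> card (x ` S)"
      using \<open>finite S\<close> by (intro card_mono) auto
    also have "\<dots> \<le> card S"
      using \<open>finite S\<close> by (rule card_image_le)
    finally show False
      using \<open>card S < N\<close> by (simp add: card_image)
  qed
  then obtain j where j: "j < N" "N * x v + j \<notin> x ` S"
    by auto
  define t where "t = N * x v + j"
  have t: "t \<notin> x ` S" "t div N = x v"
    using j by (auto simp: t_def)
  have "0 < x v"
    using pos \<open>v \<in> S\<close> by blast
  then have "0 < t"
    using \<open>2 \<le> N\<close> by (simp add: t_def)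
  have "t \<noteq> t div N"
    using t \<open>v \<in> S\<close> by auto
  define y where "y = x(w := t)"
  have y: "y a = x a" if "a \<in> S" for a
    using that \<open>w \<notin> S\<close> by (auto simp: y_def)
  have yw: "y w = t"
    by (simp add: y_def)
  have im: "y ` insert w S = insert t (x ` S)"
    using y yw by (auto simp: image_iff)
  have nb': "w \<rightarrow>\<^bsub>G\<^esub> u \<longleftrightarrow> u = v" if "u \<in> S" for u
    using nb[OF that] arcs_ends_symmetric[OF sym_arcs] by blast
  have "parent_labelling N (insert w S) y"
    unfolding parent_labelling_def
  proof (intro conjI ballI)
    have "inj_on y S"
      using inj y by (simp cong: inj_on_cong)
    then show "inj_on y (insert w S)"
      using t y yw \<open>w \<notin> S\<close> by (auto simp: image_iff)
  next
    fix a assume a: "a \<in> insert w S"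
    then show "0 < y a"
      using pos y yw \<open>0 < t\<close> by auto
    show "y a div N \<in> insert 0 (y ` insert w S)"
      unfolding im using a closed[of a] y[of a] yw t \<open>v \<in> S\<close> by (cases "a = w") auto
  next
    fix a b assume ab: "a \<in> insert w S" "b \<in> insert w S"
    \<comment> \<open>Closedness and freshness exclude \<open>t\<close> as a parent label in
      \<open>S\<close>; injectivity then leaves \<open>v\<close> as the only vertex labelled
      \<open>t div N\<close>.\<close>
    have S_w: "x u = t div N \<or> t = x u div N \<longleftrightarrow> u = v" if "u \<in> S" for u
    proof -
      have "t \<noteq> x u div N"
        using closed[OF that] t(1) \<open>0 < t\<close> by (metis insertE less_irrefl)
      then show ?thesis
        using inj that \<open>v \<in> S\<close> by (simp add: t(2) inj_on_eq_iff)
    qed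
    consider "a = w" "b = w" | "a \<in> S" "b \<in> S" | "a = w" "b \<in> S" | "a \<in> S" "b = w"
      using ab by auto
    then show "a \<rightarrow>\<^bsub>G\<^esub> b \<longleftrightarrow> y a = y b div N \<or> y b = y a div N"
    proof cases
      case 1
      then show ?thesis
        using \<open>t \<noteq> t div N\<close> yw adj_not_same by auto
    next
      case 2
      then show ?thesis
        by (simp add: adj y)
    next
      case 3
      then show ?thesis
        using S_w[of b] nb'[of b] by (auto simp: y yw)
    next
      case 4
      then show ?thesis
        using S_w[of a] nb[of a] by (auto simp: y yw)
    qed
  qed
  then show ?thesis ..
qed

text \<open>The labelled set grows from one vertex by an outside neighbour at a time; acyclicity
  gives each new vertex a single neighbour in the current set.\<close>

lemma undirected_tree_single_approval:
  assumes "undirected_tree G"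
  shows "single_approval_interval_graph G"
proof -
  have G: "graph G" and conn: "Digraph_Component.connected G"
    and acyclic: "\<not> (\<exists>p. pre_digraph.cycle G p \<and> 3 \<le> length p)"
    using assms by (auto simp: undirected_tree_def)
  interpret graph G by fact
  \<comment> \<open>\<open>connected\<close> refers to the symmetric closure, whose reachability
    agrees with that of the symmetric graph \<open>G\<close>.\<close>
  have sc: "strongly_connected G"
    using conn reachable_mk_symmetric_eq[OF sym_arcs]
    by (simp add: connected_def strongly_connected_def)
  \<comment> \<open>The successor ensures \<open>2 \<le> N\<close> even for a single vertex.\<close>
  define N where "N = Suc (card (verts G))"
  have "0 < card (verts G)"
    using sc by (auto simp: strongly_connected_def card_gt_0_iff)
  then have "2 \<le> N"
    by (simp add: N_def)
  have "\<exists>S x. S \<subseteq> verts G \<and> card S = k \<and> apath_connected S \<and> parent_labelling N S x"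
    if "1 \<le> k" "k \<le> card (verts G)" for k
    using that
  proof (induction k rule: dec_induct)
    case base
    obtain r where "r \<in> verts G"
      using sc by (auto simp: strongly_connected_def)
    then have "apath_connected {r}"
      by (auto simp: apath_connected_def intro!: exI[of _ "[]"] simp: apath_Nil_iff)
    \<comment> \<open>The root label 1 has parent label \<open>1 div N = 0\<close>.\<close>
    moreover have "parent_labelling N {r} (\<lambda>_. 1)"
      using \<open>2 \<le> N\<close> adj_not_same by (auto simp: parent_labelling_def)
    ultimately show ?case
      using \<open>r \<in> verts G\<close> by (intro exI[of _ "{r}"]) auto
  next
    case (step k)
    then obtain S x where S: "S \<subseteq> verts G" "card S = k" "apath_connected S"
      and x: "parent_labelling N S x"
      by auto
    have "finite S"
      using S(1) finite_verts finite_subset by blast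
    have "S \<noteq> {}" "S \<noteq> verts G"
      using S step by auto
    then obtain u u' where "u \<in> S" "u' \<notin> S" "u' \<in> verts G"
      using S(1) by blast
    then have "u \<rightarrow>\<^sup>*\<^bsub>G\<^esub> u'"
      using sc S(1) by (auto simp: strongly_connected_def)
    then obtain v w where vw: "v \<in> S" "w \<notin> S" "v \<rightarrow>\<^bsub>G\<^esub> w"
      using obtain_arc_leaving \<open>u \<in> S\<close> \<open>u' \<notin> S\<close> by blast
    have nb: "a \<rightarrow>\<^bsub>G\<^esub> w \<longleftrightarrow> a = v" if "a \<in> S" for a
      using unique_neighbour_if_acyclic[OF acyclic S(3) that vw(1,2)] vw(3) by blast
    obtain y where "parent_labelling N (insert w S) y"
      using parent_labelling_insert[OF x \<open>finite S\<close> _ \<open>2 \<le> N\<close> vw(1,2) nb] S(2) step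
      by (auto simp: N_def)
    moreover have "apath_connected (insert w S)"
      using apath_connected_insert[OF S(3) vw] .
    moreover have "insert w S \<subseteq> verts G"
      using S(1) vw(3) adj_in_verts by blast
    moreover have "card (insert w S) = Suc k"
      using S(2) \<open>finite S\<close> vw by simp
    ultimately show ?case
      by blast
  qed
  then obtain S x where "S \<subseteq> verts G" "card S = card (verts G)" "parent_labelling N S x"
    using \<open>0 < card (verts G)\<close> by (metis One_nat_def Suc_leI order_refl)
  moreover from this have "S = verts G"
    by (simp add: card_subset_eq)
  ultimately show ?thesis
    using single_approval_interval_graph_if_parent_labelling[OF G \<open>2 \<le> N\<close>, of x]
    by (auto simp: parent_labelling_def)
qed

theorem theorem23:
  shows "(\<forall>n\<ge>1. \<forall>G :: ('a,'b) pre_digraph.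
            complete_digraph n G \<longrightarrow> single_approval_interval_graph G) \<and>
         (\<forall>n\<ge>3. \<forall>G :: ('a,'b) pre_digraph.
            cycle_graph n G \<longrightarrow> single_approval_interval_graph G) \<and>
         (\<forall>n\<ge>3. \<forall>G :: ('a,'b) pre_digraph.
            wheel_graph n G \<longrightarrow> single_approval_interval_graph G) \<and>
         (\<forall>G :: ('a,'b) pre_digraph.
            undirected_tree G \<longrightarrow> single_approval_interval_graph G) \<and>
         (\<forall>k\<ge>1. \<forall>G :: ('a,'b) pre_digraph.
            complete_multipartite_graph k G \<longrightarrow> single_approval_interval_graph G)"
proof (intro conjI allI impI)
  fix n :: nat and G :: "('a,'b) pre_digraph"
  assume "complete_digraph n G"
  then show "single_approval_interval_graph G"
    by (rule complete_digraph_single_approval)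
next
  fix n :: nat and G :: "('a,'b) pre_digraph"
  assume "3 \<le> n" "cycle_graph n G"
  then show "single_approval_interval_graph G"
    by (rule cycle_graph_single_approval)
next
  fix n :: nat and G :: "('a,'b) pre_digraph"
  assume n: "3 \<le> n" and "wheel_graph n G"
  then obtain c where "graph G" "cycle_graph n (G \<restriction> (verts G - {c}))"
    and "\<forall>v\<in>verts G - {c}. c \<rightarrow>\<^bsub>G\<^esub> v"
    unfolding wheel_graph_def by metis
  with cycle_graph_single_approval[OF n] show "single_approval_interval_graph G"
    by (intro single_approval_interval_graph_dominating_vertex[of G c]) simp_all
next
  fix G :: "('a,'b) pre_digraph"
  assume "undirected_tree G"
  then show "single_approval_interval_graph G"
    by (rule undirected_tree_single_approval)
next
  fix k :: nat and G :: "('a,'b) pre_digraph"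
  assume "complete_multipartite_graph k G"
  then show "single_approval_interval_graph G"
    by (rule complete_multipartite_single_approval)
qed

end
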